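(* Let $p(x) = \det\left(\sum_{i=1}^{n}A_ix_i\right)$, $x\in\mathbb{R}^n$, where $A_1,\ldots,A_n$ are real symmetric $\ell\times \ell$ matrices, and let $e=(e_1,\ldots,e_n)\in\mathbb{R}^n$ be such that $A_0 = \sum_{i=1}^{n}A_i e_i$ is positive definite. Then $\Lambda_+(D_ep,e)$ has a spectrahedral representation of size $\binom{\ell+1}{2}-1$.
   Context: A homogeneous real polynomial $p$ in $n$ variables is hyperbolic with respect to $e\in\mathbb{R}^n$ if $p(e)\neq 0$ and for all $x\in\mathbb{R}^n$ the univariate polynomial $t\mapsto p(x-te)$ has only real roots. Its closed hyperbolicity cone is $\Lambda_+(p,e)=\{x\in\mathbb{R}^n : \text{all roots of } t\mapsto p(x-te) \text{ are non-negative}\}$. $D_ep(x)=\left.\frac{d}{dt}p(x+te)\right|_{t=0}$ is the directional derivative of $p$ in direction $e$. If $p$ is hyperbolic with respect to $e$, then so is $D_ep$; the polynomial $p$ in the statement is hyperbolic with respect to $e$. A convex cone $K\subseteq\mathbb{R}^n$ has a spectrahedral representation of size $N$ if there are real symmetric $N\times N$ matrices $C_1,\ldots,C_n$ such that $K=\{x\in\mathbb{R}^n : \sum_{i=1}^n C_ix_i\succeq 0\}$, where $\succeq 0$ means positive semidefinite (a $0\times 0$ matrix is regarded as positive semidefinite). *)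

theory Defs
  imports
    "HOL-Analysis.Analysis"
    "Jordan_Normal_Form.Determinant"
begin

text \<open>
  Real polynomials in finitely many variables are represented by the functions they induce
  on \<^typ>\<open>real^'n\<close>. Matrices are those of \<^theory>\<open>Jordan_Normal_Form.Matrix\<close>, because sizes
  occurring below are natural number expressions that can be zero.
\<close>

definition dir_deriv :: "real ^ 'n \<Rightarrow> (real ^ 'n \<Rightarrow> real) \<Rightarrow> real ^ 'n \<Rightarrow> real" where
  "dir_deriv e p x = deriv (\<lambda>t. p (x + t *\<^sub>R e)) 0"

text \<open>
  The univariate polynomial \<open>t \<mapsto> p (x - t e)\<close>; it exists uniquely whenever \<open>p\<close> is a polynomial
  function, see \<open>line_poly_ex1\<close> below. It is needed as a polynomial in order to speak about
  its complex roots.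
\<close>

definition line_poly :: "(real ^ 'n \<Rightarrow> real) \<Rightarrow> real ^ 'n \<Rightarrow> real ^ 'n \<Rightarrow> real poly" where
  "line_poly p e x = (THE q. \<forall>t. poly q t = p (x - t *\<^sub>R e))"

definition line_roots :: "(real ^ 'n \<Rightarrow> real) \<Rightarrow> real ^ 'n \<Rightarrow> real ^ 'n \<Rightarrow> complex set" where
  "line_roots p e x = {z. poly (map_poly complex_of_real (line_poly p e x)) z = 0}"

definition homogeneous :: "(real ^ 'n \<Rightarrow> real) \<Rightarrow> bool" where
  "homogeneous p \<longleftrightarrow> (\<exists>d::nat. \<forall>c x. p (c *\<^sub>R x) = c ^ d * p x)"

definition hyperbolic :: "(real ^ 'n \<Rightarrow> real) \<Rightarrow> real ^ 'n \<Rightarrow> bool" where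
  "hyperbolic p e \<longleftrightarrow>
     real_polynomial_function p \<and> homogeneous p \<and> p e \<noteq> 0 \<and> (\<forall>x. line_roots p e x \<subseteq> \<real>)"

text \<open>
  ``All roots are non-negative'' ranges over the complex roots. For hyperbolic \<open>p\<close> these are
  real, so that it suffices to look at real roots: see \<open>hyperbolicity_cone_eq\<close>.
\<close>

definition hyperbolicity_cone :: "(real ^ 'n \<Rightarrow> real) \<Rightarrow> real ^ 'n \<Rightarrow> (real ^ 'n) set" where
  "hyperbolicity_cone p e = {x. line_roots p e x \<subseteq> \<real>\<^sub>\<ge>\<^sub>0}"

definition sym_mat :: "nat \<Rightarrow> real mat \<Rightarrow> bool" where
  "sym_mat N M \<longleftrightarrow> M \<in> carrier_mat N N \<and> transpose_mat M = M"

definition psd_mat :: "nat \<Rightarrow> real mat \<Rightarrow> bool" where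
  "psd_mat N M \<longleftrightarrow> sym_mat N M \<and> (\<forall>v \<in> carrier_vec N. 0 \<le> scalar_prod v (M *\<^sub>v v))"

definition pd_mat :: "nat \<Rightarrow> real mat \<Rightarrow> bool" where
  "pd_mat N M \<longleftrightarrow>
     sym_mat N M \<and> (\<forall>v \<in> carrier_vec N. v \<noteq> 0\<^sub>v N \<longrightarrow> 0 < scalar_prod v (M *\<^sub>v v))"

text \<open>
  \<open>\<Sum>\<^sub>k x\<^sub>k C\<^sub>k\<close>, written entrywise since matrices of a given size do not form a type.
\<close>

definition lin_pencil :: "nat \<Rightarrow> ('n::finite \<Rightarrow> real mat) \<Rightarrow> real ^ 'n \<Rightarrow> real mat" where
  "lin_pencil N C x = mat N N (\<lambda>(i, j). \<Sum>k\<in>UNIV. C k $$ (i, j) * vec_nth x k)"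

definition spectrahedral_rep :: "nat \<Rightarrow> (real ^ 'n::finite) set \<Rightarrow> bool" where
  "spectrahedral_rep N K \<longleftrightarrow>
     (\<exists>C. (\<forall>k. sym_mat N (C k)) \<and> K = {x. psd_mat N (lin_pencil N C x)})"

lemma line_poly_ex1:
  assumes "real_polynomial_function p"
  shows "\<exists>!q. \<forall>t. poly q t = p (x - t *\<^sub>R e)"
proof -
  have "\<exists>q. \<forall>t. poly q t = p (x - t *\<^sub>R e)"
    using assms
  proof (induction rule: real_polynomial_function.induct)
    case (linear f)
    then have "poly [:f x, - f e:] t = f (x - t *\<^sub>R e)" for t
      by (simp add: linear_diff linear_cmul bounded_linear.linear)
    then show ?case by blast
  next
    case (const c)
    have "poly [:c:] t = c" for t by simp
    then show ?case by blast
  next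
    case (add f g)
    then show ?case by (metis poly_add)
  next
    case (mult f g)
    then show ?case by (metis poly_mult)
  qed
  moreover have "q = r"
    if "\<forall>t. poly q t = p (x - t *\<^sub>R e)" "\<forall>t. poly r t = p (x - t *\<^sub>R e)" for q r
    using that by (metis poly_eq_poly_eq_iff ext)
  ultimately show ?thesis by blast
qed

lemma poly_line_poly:
  assumes "real_polynomial_function p"
  shows "poly (line_poly p e x) t = p (x - t *\<^sub>R e)"
  using theI'[OF line_poly_ex1[OF assms, of x e]] by (simp add: line_poly_def)

lemma hyperbolicity_cone_eq:
  assumes "hyperbolic p e"
  shows "hyperbolicity_cone p e = {x. \<forall>t. p (x - t *\<^sub>R e) = 0 \<longrightarrow> 0 \<le> t}"
proof -
  have *: "complex_of_real t \<in> line_roots p e x \<longleftrightarrow> p (x - t *\<^sub>R e) = 0" for t x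
  proof -
    have "poly (map_poly complex_of_real q) (complex_of_real t) = complex_of_real (poly q t)" for q
      by (induction q) (simp_all add: map_poly_pCons)
    then show ?thesis
      using assms by (simp add: line_roots_def hyperbolic_def poly_line_poly)
  qed
  have "line_roots p e x \<subseteq> \<real>\<^sub>\<ge>\<^sub>0 \<longleftrightarrow> (\<forall>t. p (x - t *\<^sub>R e) = 0 \<longrightarrow> 0 \<le> t)" for x
  proof
    assume "line_roots p e x \<subseteq> \<real>\<^sub>\<ge>\<^sub>0"
    then show "\<forall>t. p (x - t *\<^sub>R e) = 0 \<longrightarrow> 0 \<le> t"
      using *[of _ x] nonneg_Reals_of_real_iff by blast
  next
    assume r: "\<forall>t. p (x - t *\<^sub>R e) = 0 \<longrightarrow> 0 \<le> t"
    show "line_roots p e x \<subseteq> \<real>\<^sub>\<ge>\<^sub>0"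
    proof
      fix z assume z: "z \<in> line_roots p e x"
      then have "z \<in> \<real>" using assms by (auto simp: hyperbolic_def)
      then obtain t where "z = complex_of_real t" by (auto elim: Reals_cases)
      then show "z \<in> \<real>\<^sub>\<ge>\<^sub>0" using z r * by simp
    qed
  qed
  then show ?thesis by (simp add: hyperbolicity_cone_def)
qed

end

theory Submission
  imports Defs "Jordan_Normal_Form.Spectral_Radius"
begin

text \<open>
  Write \<open>X\<close> for the pencil at \<open>x\<close> and \<open>G\<close> for the pencil at \<open>e\<close>. The spectrahedral representation is
  the Gram matrix of the quadratic form \<open>Y \<mapsto> tr (X Y G Y)\<close> on the space of symmetric \<open>Y\<close> with
  \<open>tr (G Y) = 0\<close>, which has dimension \<open>(l + 1 choose 2) - 1\<close> and depends only on \<open>e\<close>.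
  If \<open>P\<close> satisfies \<open>P\<^sup>T G P = 1\<close> and \<open>P\<^sup>T X P = diag \<lambda>\<close>, the substitution \<open>Y = P Z P\<^sup>T\<close> turns the form into
  \<open>\<Sum>\<^sub>i\<^sub>j \<lambda>\<^sub>i Z\<^sub>i\<^sub>j\<^sup>2\<close> with \<open>tr Z = 0\<close>. Off the diagonal it has the coefficients \<open>\<lambda>\<^sub>i + \<lambda>\<^sub>j\<close>, so it is
  positive semidefinite iff \<open>\<Sum>\<^sub>i \<lambda>\<^sub>i y\<^sub>i\<^sup>2 \<ge> 0\<close> whenever \<open>\<Sum>\<^sub>i y\<^sub>i = 0\<close>. Up to a nonzero factor,
  \<open>t \<mapsto> D\<^sub>e p (x - t e)\<close> is the derivative of \<open>\<Prod>\<^sub>i (\<lambda>\<^sub>i - t)\<close>. A root \<open>t\<close> of it that is no \<open>\<lambda>\<^sub>i\<close>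
  yields the vector \<open>y\<^sub>i = 1 / (\<lambda>\<^sub>i - t)\<close> with \<open>\<Sum>\<^sub>i y\<^sub>i = 0\<close> and \<open>\<Sum>\<^sub>i \<lambda>\<^sub>i y\<^sub>i\<^sup>2 = t \<Sum>\<^sub>i y\<^sub>i\<^sup>2\<close>. Conversely, if no root
  is negative, then by Rolle's theorem at most one \<open>\<lambda>\<^sub>a\<close> is negative and then all others are
  positive; the sign of the derivative at \<open>0\<close> gives \<open>\<Sum>\<^sub>i 1 / \<lambda>\<^sub>i \<le> 0\<close>, and Cauchy-Schwarz concludes.
\<close>

subsection \<open>Simultaneous diagonalization\<close>

unbundle no vec_syntax
unbundle no inner_syntax

section \<open>Bilinear forms of symmetric and positive definite matrices\<close>

lemma sym_mat_form_commute:
  assumes "sym_mat n X" "a \<in> carrier_vec n" "b \<in> carrier_vec n"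
  shows "a \<bullet> (X *\<^sub>v b) = b \<bullet> (X *\<^sub>v a)"
proof -
  have X: "X \<in> carrier_mat n n" "transpose_mat X = X" using assms by (auto simp: sym_mat_def)
  have "a \<bullet> (X *\<^sub>v b) = (X *\<^sub>v a) \<bullet> b"
    using transpose_vec_mult_scalar[OF X(1) assms(3,2)] X(2) by simp
  also have "\<dots> = b \<bullet> (X *\<^sub>v a)"
    by (rule comm_scalar_prod) (use X assms in auto)
  finally show ?thesis .
qed

lemma pd_mat_form_pos:
  assumes "pd_mat n G" "a \<in> carrier_vec n" "a \<noteq> 0\<^sub>v n"
  shows "0 < a \<bullet> (G *\<^sub>v a)"
  using assms by (simp add: pd_mat_def)

lemma pd_mat_form_nonneg:
  assumes "pd_mat n G" "a \<in> carrier_vec n"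
  shows "0 \<le> a \<bullet> (G *\<^sub>v a)"
proof (cases "a = 0\<^sub>v n")
  case True
  have "G \<in> carrier_mat n n" using assms by (simp add: pd_mat_def sym_mat_def)
  then show ?thesis using True by simp
qed (use pd_mat_form_pos assms in force)

lemma pd_mat_right_inverse:
  assumes "pd_mat n G"
  obtains H where "H \<in> carrier_mat n n" "G * H = 1\<^sub>m n"
proof -
  have G: "G \<in> carrier_mat n n" using assms by (simp add: pd_mat_def sym_mat_def)
  have "det G \<noteq> 0"
    unfolding det_0_iff_vec_prod_zero[OF G] using pd_mat_form_pos[OF assms] by fastforce
  from det_non_zero_imp_unit[OF G this, of "()"] show ?thesis
    using that by (auto simp: Units_def ring_mat_def)
qed

text \<open>Over the complex numbers the inverse of \<open>G\<close> times \<open>X\<close> has an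
  eigenvector. Symmetry of \<open>X\<close> and \<open>G\<close> makes its eigenvalue real, so a
  nonzero real or imaginary part is a real generalized eigenvector, which is then normalized in the
  form of \<open>G\<close>.\<close>

lemma pencil_eigenvector:
  assumes X: "sym_mat n X" and G: "pd_mat n G" and n: "0 < n"
  obtains \<mu> v where "v \<in> carrier_vec n" "X *\<^sub>v v = \<mu> \<cdot>\<^sub>v (G *\<^sub>v v)" "v \<bullet> (G *\<^sub>v v) = 1"
proof -
  have Xc: "X \<in> carrier_mat n n" and Gc: "G \<in> carrier_mat n n" and Gs: "sym_mat n G"
    using X G by (auto simp: pd_mat_def sym_mat_def)
  obtain H where H: "H \<in> carrier_mat n n" "G * H = 1\<^sub>m n" using pd_mat_right_inverse[OF G] .
  define M where "M = H * X"
  have M: "M \<in> carrier_mat n n" using H Xc by (simp add: M_def)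
  have GM: "G *\<^sub>v (M *\<^sub>v w) = X *\<^sub>v w" if "w \<in> carrier_vec n" for w
  proof -
    have "G *\<^sub>v (M *\<^sub>v w) = G *\<^sub>v (H *\<^sub>v (X *\<^sub>v w))"
      using that H Xc by (simp add: M_def assoc_mult_mat_vec[of _ n n _ n])
    also have "\<dots> = (G * H) *\<^sub>v (X *\<^sub>v w)"
      using that Gc H Xc by (intro assoc_mult_mat_vec[symmetric]) auto
    finally show ?thesis using that H Xc by simp
  qed
  obtain z u where u: "u \<in> carrier_vec n" "u \<noteq> 0\<^sub>v n"
    "map_mat complex_of_real M *\<^sub>v u = z \<cdot>\<^sub>v u"
    using spectrum_non_empty[of "map_mat complex_of_real M" n] M n
    by (auto simp: spectrum_def eigenvalue_def eigenvector_def)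
  define a b where "a = map_vec Re u" and "b = map_vec Im u"
  have ab: "a \<in> carrier_vec n" "b \<in> carrier_vec n" using u by (auto simp: a_def b_def)
  have entry: "(\<Sum>j<n. complex_of_real (M $$ (i, j)) * u $ j) = z * u $ i" if "i < n" for i
  proof -
    have "(\<Sum>j<n. complex_of_real (M $$ (i, j)) * u $ j) = (map_mat complex_of_real M *\<^sub>v u) $ i"
      using that M u(1) by (simp add: scalar_prod_def atLeast0LessThan)
    also have "\<dots> = z * u $ i" unfolding u(3) using that u(1) by simp
    finally show ?thesis .
  qed
  have Ma: "M *\<^sub>v a = Re z \<cdot>\<^sub>v a - Im z \<cdot>\<^sub>v b"
  proof (rule eq_vecI)
    fix i assume "i < dim_vec (Re z \<cdot>\<^sub>v a - Im z \<cdot>\<^sub>v b)"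
    then have i: "i < n" using ab by simp
    show "(M *\<^sub>v a) $ i = (Re z \<cdot>\<^sub>v a - Im z \<cdot>\<^sub>v b) $ i"
      using arg_cong[OF entry[OF i], of Re] i M u
      by (simp add: scalar_prod_def atLeast0LessThan a_def b_def)
  qed (use M ab in auto)
  have Mb: "M *\<^sub>v b = Im z \<cdot>\<^sub>v a + Re z \<cdot>\<^sub>v b"
  proof (rule eq_vecI)
    fix i assume "i < dim_vec (Im z \<cdot>\<^sub>v a + Re z \<cdot>\<^sub>v b)"
    then have i: "i < n" using ab by simp
    show "(M *\<^sub>v b) $ i = (Im z \<cdot>\<^sub>v a + Re z \<cdot>\<^sub>v b) $ i"
      using arg_cong[OF entry[OF i], of Im] i M u
      by (simp add: scalar_prod_def atLeast0LessThan a_def b_def)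
  qed (use M ab in auto)
  have Xa: "X *\<^sub>v a = Re z \<cdot>\<^sub>v (G *\<^sub>v a) - Im z \<cdot>\<^sub>v (G *\<^sub>v b)"
    using GM[OF ab(1)] ab Gc by (simp add: Ma mult_minus_distrib_mat_vec[of _ n n] mult_mat_vec[of _ n n])
  have Xb: "X *\<^sub>v b = Im z \<cdot>\<^sub>v (G *\<^sub>v a) + Re z \<cdot>\<^sub>v (G *\<^sub>v b)"
    using GM[OF ab(2)] ab Gc by (simp add: Mb mult_add_distrib_mat_vec[of _ n n] mult_mat_vec[of _ n n])
  have nz: "a \<noteq> 0\<^sub>v n \<or> b \<noteq> 0\<^sub>v n"
  proof (rule ccontr)
    assume "\<not> ?thesis"
    then have *: "a = 0\<^sub>v n" "b = 0\<^sub>v n" by auto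
    have "u $ i = 0" if "i < n" for i
    proof -
      have "a $ i = 0" "b $ i = 0" using * that by auto
      then show ?thesis using that u by (simp add: a_def b_def complex_eq_iff)
    qed
    then have "u = 0\<^sub>v n" using u by (intro eq_vecI) auto
    then show False using u by simp
  qed
  \<comment> \<open>Expanding both sides by \<open>Xa\<close> and \<open>Xb\<close> cancels the
    \<open>Re z\<close> terms and leaves \<open>Im z\<close> times a positive sum.\<close>
  have "b \<bullet> (X *\<^sub>v a) = a \<bullet> (X *\<^sub>v b)" using sym_mat_form_commute[OF X ab(2,1)] .
  moreover have "b \<bullet> (X *\<^sub>v a) = Re z * (b \<bullet> (G *\<^sub>v a)) - Im z * (b \<bullet> (G *\<^sub>v b))"
    using ab Gc by (simp add: Xa scalar_prod_minus_distrib[of _ n])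
  moreover have "a \<bullet> (X *\<^sub>v b) = Im z * (a \<bullet> (G *\<^sub>v a)) + Re z * (a \<bullet> (G *\<^sub>v b))"
    using ab Gc by (simp add: Xb scalar_prod_add_distrib[of _ n])
  moreover have "a \<bullet> (G *\<^sub>v b) = b \<bullet> (G *\<^sub>v a)" using sym_mat_form_commute[OF Gs ab] .
  ultimately have "Im z * (a \<bullet> (G *\<^sub>v a) + b \<bullet> (G *\<^sub>v b)) = 0" by (simp add: algebra_simps)
  moreover have "a \<bullet> (G *\<^sub>v a) + b \<bullet> (G *\<^sub>v b) > 0"
    using nz pd_mat_form_pos[OF G] pd_mat_form_nonneg[OF G] ab
    by (meson add_nonneg_pos add_pos_nonneg)
  ultimately have "Im z = 0" by simp
  then have X': "X *\<^sub>v a = Re z \<cdot>\<^sub>v (G *\<^sub>v a)" "X *\<^sub>v b = Re z \<cdot>\<^sub>v (G *\<^sub>v b)"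
    unfolding Xa Xb using ab Gc by auto
  obtain w where w: "w \<in> carrier_vec n" "w \<noteq> 0\<^sub>v n" "X *\<^sub>v w = Re z \<cdot>\<^sub>v (G *\<^sub>v w)"
    using nz ab X' by blast
  define c where "c = w \<bullet> (G *\<^sub>v w)"
  have c: "c > 0" using pd_mat_form_pos[OF G] w by (simp add: c_def)
  define v where "v = (1 / sqrt c) \<cdot>\<^sub>v w"
  show ?thesis
  proof
    show "v \<in> carrier_vec n" using w by (simp add: v_def)
    show "X *\<^sub>v v = Re z \<cdot>\<^sub>v (G *\<^sub>v v)"
      using w Xc Gc by (simp add: v_def mult_mat_vec[of _ n n] smult_smult_assoc mult.commute)
    have "v \<bullet> (G *\<^sub>v v) = c / (sqrt c * sqrt c)"
      using w Gc by (simp add: v_def mult_mat_vec[of _ n n] c_def)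
    then show "v \<bullet> (G *\<^sub>v v) = 1" using c by simp
  qed
qed

text \<open>Induction on the dimension: split off one generalized eigenvector \<open>v\<close> and
  restrict both forms to its \<open>G\<close>-orthogonal complement.\<close>

lemma simultaneous_diagonalization:
  assumes "sym_mat n X" and "pd_mat n G"
  shows "\<exists>b lam. (\<forall>i<n. b i \<in> carrier_vec n) \<and>
    (\<forall>i<n. \<forall>j<n. b i \<bullet> (G *\<^sub>v b j) = (if i = j then 1 else 0)) \<and>
    (\<forall>i<n. \<forall>j<n. b i \<bullet> (X *\<^sub>v b j) = (if i = j then lam i else 0))"
  using assms
proof (induction n arbitrary: X G)
  case 0
  then show ?case by simp
next
  case (Suc n)
  note X = Suc.prems(1) and G = Suc.prems(2)
  have Xc: "X \<in> carrier_mat (Suc n) (Suc n)" and Gc: "G \<in> carrier_mat (Suc n) (Suc n)"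
    and Gs: "sym_mat (Suc n) G"
    using X G by (auto simp: pd_mat_def sym_mat_def)
  obtain \<mu> v where v: "v \<in> carrier_vec (Suc n)" "X *\<^sub>v v = \<mu> \<cdot>\<^sub>v (G *\<^sub>v v)" "v \<bullet> (G *\<^sub>v v) = 1"
    using pencil_eigenvector[OF X G] by blast
  define w where "w = G *\<^sub>v v"
  have wc: "w \<in> carrier_vec (Suc n)" using Gc v by (auto simp: w_def)
  have "w \<noteq> 0\<^sub>v (Suc n)" using v by (auto simp: w_def)
  \<comment> \<open>The complement is the hyperplane \<open>w \<bullet> y = 0\<close>. As
    \<open>w $ k\<close> is nonzero, coordinate \<open>k\<close> can be solved for;
    \<open>insert_index k\<close> enumerates the other coordinates.\<close>
  then obtain k where k: "k < Suc n" "w $ k \<noteq> 0"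
    using wc by (metis carrier_vecD eq_vecI index_zero_vec)
  (* the columns of U form a basis of the G-orthogonal complement of v *)
  define U where "U = mat (Suc n) n (\<lambda>(i, j). if i = k then - w $ insert_index k j / w $ k
      else if i = insert_index k j then 1 else 0)"
  have U: "U \<in> carrier_mat (Suc n) n" by (simp add: U_def)
  have Uc: "U *\<^sub>v c \<in> carrier_vec (Suc n)" for c
    by (rule carrier_vecI) (simp add: U_def)
  have ins: "insert_index k j < Suc n" "insert_index k j \<noteq> k" if "j < n" for j
    using that by (auto simp: insert_index_def)
  have ins_eq: "insert_index k i = insert_index k j \<longleftrightarrow> i = j" for i j
    by (auto simp: insert_index_def)
  have wU: "w \<bullet> (U *\<^sub>v c) = 0" if c: "c \<in> carrier_vec n" for c
  proof -
    have "(transpose_mat U *\<^sub>v w) $ j = 0" if j: "j < n" for j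
    proof -
      have "(transpose_mat U *\<^sub>v w) $ j = (\<Sum>i<Suc n. U $$ (i, j) * w $ i)"
        using j U wc by (simp add: scalar_prod_def atLeast0LessThan)
      also have "\<dots> = (\<Sum>i<Suc n. (if i = k then - w $ insert_index k j else 0)
          + (if i = insert_index k j then w $ insert_index k j else 0))"
        using j k ins[OF j] by (intro sum.cong) (auto simp: U_def)
      also have "\<dots> = 0"
        using k ins[OF j] by (simp add: sum.distrib del: sum.lessThan_Suc)
      finally show ?thesis .
    qed
    then have "transpose_mat U *\<^sub>v w = 0\<^sub>v n" using U by (intro eq_vecI) auto
    then show ?thesis using transpose_vec_mult_scalar[OF U c wc] c by simp
  qed
  \<comment> \<open>Away from row \<open>k\<close>, the vector \<open>U *\<^sub>v c\<close> just
    lists the entries of \<open>c\<close>, so \<open>U\<close> is injective. This keeps the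
    compression of \<open>G\<close> positive definite.\<close>
  have Unz: "U *\<^sub>v c \<noteq> 0\<^sub>v (Suc n)" if c: "c \<in> carrier_vec n" "c \<noteq> 0\<^sub>v n" for c
  proof
    assume *: "U *\<^sub>v c = 0\<^sub>v (Suc n)"
    have "c $ j = 0" if j: "j < n" for j
    proof -
      have "(U *\<^sub>v c) $ insert_index k j = (\<Sum>i<n. U $$ (insert_index k j, i) * c $ i)"
        using ins[OF j] U c by (simp add: scalar_prod_def atLeast0LessThan)
      also have "\<dots> = (\<Sum>i<n. if i = j then c $ j else 0)"
        using ins[OF j] by (intro sum.cong) (auto simp: U_def ins_eq)
      finally show ?thesis using * ins[OF j] j by simp
    qed
    then have "c = 0\<^sub>v n" using c by (intro eq_vecI) auto
    then show False using c by simp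
  qed
  define compress where "compress M = transpose_mat U * (M * U)" for M :: "real mat"
  have form: "c \<bullet> (compress M *\<^sub>v d) = (U *\<^sub>v c) \<bullet> (M *\<^sub>v (U *\<^sub>v d))"
    if "M \<in> carrier_mat (Suc n) (Suc n)" "c \<in> carrier_vec n" "d \<in> carrier_vec n" for M c d
  proof -
    have "compress M *\<^sub>v d = transpose_mat U *\<^sub>v (M *\<^sub>v (U *\<^sub>v d))"
      using that U by (simp add: compress_def assoc_mult_mat_vec[of _ n "Suc n" _ n]
        assoc_mult_mat_vec[of _ "Suc n" "Suc n" _ n])
    moreover have MU: "M *\<^sub>v (U *\<^sub>v d) \<in> carrier_vec (Suc n)" using that Uc by auto
    ultimately show ?thesis
      using transpose_vec_mult_scalar[OF U that(2) MU] that U Uc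
      by (simp add: comm_scalar_prod[of c n] comm_scalar_prod[of "M *\<^sub>v (U *\<^sub>v d)" "Suc n"])
  qed
  have sym: "sym_mat n (compress M)" if "sym_mat (Suc n) M" for M
    using that U by (auto simp: compress_def sym_mat_def transpose_mult[of _ n "Suc n" _ n]
       transpose_mult[of _ "Suc n" "Suc n" _ n] assoc_mult_mat[of _ n "Suc n" _ "Suc n" _ n])
  have "pd_mat n (compress G)"
    unfolding pd_mat_def
  proof (intro conjI ballI impI)
    fix c :: "real vec" assume c: "c \<in> carrier_vec n" "c \<noteq> 0\<^sub>v n"
    show "0 < c \<bullet> (compress G *\<^sub>v c)"
      unfolding form[OF Gc c(1) c(1)] by (rule pd_mat_form_pos[OF G Uc Unz[OF c]])
  qed (rule sym[OF Gs])
  from Suc.IH[OF sym[OF X] this] obtain b lam where b: "\<forall>i<n. b i \<in> carrier_vec n"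
    "\<forall>i<n. \<forall>j<n. b i \<bullet> (compress G *\<^sub>v b j) = (if i = j then 1 else 0)"
    "\<forall>i<n. \<forall>j<n. b i \<bullet> (compress X *\<^sub>v b j) = (if i = j then lam i else 0)" by blast
  define b' where "b' i = (case i of 0 \<Rightarrow> v | Suc i \<Rightarrow> U *\<^sub>v b i)" for i
  define lam' where "lam' i = (case i of 0 \<Rightarrow> \<mu> | Suc i \<Rightarrow> lam i)" for i
  have b'c: "b' i \<in> carrier_vec (Suc n)" if "i < Suc n" for i
    using that v Uc by (auto simp: b'_def split: nat.split)
  have vG: "(U *\<^sub>v b i) \<bullet> (G *\<^sub>v v) = 0" if "i < n" for i
    using wU[of "b i"] that b Uc wc comm_scalar_prod[OF wc Uc] by (simp add: w_def)
  \<comment> \<open>\<open>X\<close> maps \<open>v\<close> to a multiple of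
    \<open>G *\<^sub>v v\<close>, so orthogonality for \<open>G\<close> gives orthogonality for
    \<open>X\<close>.\<close>
  have vX: "(U *\<^sub>v b i) \<bullet> (X *\<^sub>v v) = 0" if "i < n" for i
    using vG[OF that] v Uc[of "b i"] wc by (simp add: w_def[symmetric])
  have 1: "b' i \<bullet> (G *\<^sub>v b' j) = (if i = j then 1 else 0)" if "i < Suc n" "j < Suc n" for i j
  proof (cases i)
    case 0
    then show ?thesis using that v vG sym_mat_form_commute[OF Gs v(1) Uc]
      by (cases j) (auto simp: b'_def)
  next
    case (Suc i')
    then show ?thesis using that vG b form[OF Gc] by (cases j) (auto simp: b'_def)
  qed
  have 2: "b' i \<bullet> (X *\<^sub>v b' j) = (if i = j then lam' i else 0)" if "i < Suc n" "j < Suc n" for i j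
  proof (cases i)
    case 0
    have "v \<bullet> (X *\<^sub>v v) = \<mu>" using v wc by (simp add: w_def[symmetric])
    then show ?thesis using 0 that vX sym_mat_form_commute[OF X v(1) Uc]
      by (cases j) (auto simp: b'_def lam'_def)
  next
    case (Suc i')
    then show ?thesis using that vX b form[OF Xc] by (cases j) (auto simp: b'_def lam'_def)
  qed
  show ?case using b'c 1 2 by blast
qed

lemma simultaneous_diagonalization_mat:
  assumes X: "sym_mat n X" and G: "pd_mat n G"
  obtains P lam where "P \<in> carrier_mat n n" "transpose_mat P * (G * P) = 1\<^sub>m n"
    "transpose_mat P * (X * P) = mat_diag n lam"
proof -
  obtain b lam where b: "\<forall>i<n. b i \<in> carrier_vec n"
    "\<forall>i<n. \<forall>j<n. b i \<bullet> (G *\<^sub>v b j) = (if i = j then 1 else 0)"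
    "\<forall>i<n. \<forall>j<n. b i \<bullet> (X *\<^sub>v b j) = (if i = j then lam i else 0)"
    using simultaneous_diagonalization[OF assms] by blast
  define P where "P = mat n n (\<lambda>(i, j). b j $ i)"
  have P: "P \<in> carrier_mat n n" by (simp add: P_def)
  have col: "col P j = b j" if "j < n" for j
    using that b by (intro eq_vecI) (auto simp: P_def)
  have entry: "(transpose_mat P * (M * P)) $$ (i, j) = b i \<bullet> (M *\<^sub>v b j)"
    if "M \<in> carrier_mat n n" "i < n" "j < n" for M i j
    using that P by (simp add: col)
  have Gc: "G \<in> carrier_mat n n" and Xc: "X \<in> carrier_mat n n"
    using assms by (auto simp: pd_mat_def sym_mat_def)
  show ?thesis
  proof
    show "P \<in> carrier_mat n n" by (fact P)
    show "transpose_mat P * (G * P) = 1\<^sub>m n"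
      using P Gc entry[OF Gc] b(2) by (intro eq_matI) auto
    show "transpose_mat P * (X * P) = mat_diag n lam"
      using P Xc entry[OF Xc] b(3) by (intro eq_matI) (auto simp: mat_diag_def)
  qed
qed

subsection \<open>Critical points of a product of linear factors\<close>

lemma pderiv_linear_prod:
  fixes lam :: "'a \<Rightarrow> 'b :: {idom}"
  shows "poly (pderiv (\<Prod>i\<in>I. [:lam i, -1:])) t = - (\<Sum>i\<in>I. \<Prod>j\<in>I - {i}. lam j - t)"
  by (simp add: pderiv_prod poly_sum poly_prod pderiv_pCons sum_negf)

lemma map_poly_pderiv_linear_prod:
  fixes lam :: "'a \<Rightarrow> real"
  shows "map_poly complex_of_real (pderiv (\<Prod>i\<in>I. [:lam i, -1:])) =
    pderiv (\<Prod>i\<in>I. [:complex_of_real (lam i), -1:])"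
proof -
  interpret h: map_poly_idom_hom complex_of_real ..
  show ?thesis by (simp add: hom_distribs)
qed

text \<open>This is the logarithmic derivative: away from the roots of a product of linear factors,
  its critical points are the zeros of a sum of reciprocals.\<close>

lemma sum_prod_delete_eq:
  fixes c :: "'a \<Rightarrow> 'b :: field"
  assumes "finite I" "\<And>i. i \<in> I \<Longrightarrow> c i \<noteq> 0"
  shows "(\<Sum>i\<in>I. \<Prod>j\<in>I - {i}. c j) = (\<Prod>i\<in>I. c i) * (\<Sum>i\<in>I. 1 / c i)"
  unfolding sum_distrib_left
  by (intro sum.cong) (use assms in \<open>auto simp: prod.remove[of I]\<close>)

lemma sum_prod_delete_single:
  fixes c :: "'a \<Rightarrow> 'b :: field"
  assumes "finite I" "i \<in> I" "c i = 0"
  shows "(\<Sum>a\<in>I. \<Prod>j\<in>I - {a}. c j) = (\<Prod>j\<in>I - {i}. c j)"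
proof -
  have "(\<Prod>j\<in>I - {a}. c j) = 0" if "a \<in> I - {i}" for a
    using that assms by (intro prod_zero) auto
  then have "(\<Sum>a\<in>I - {i}. \<Prod>j\<in>I - {a}. c j) = 0" by (intro sum.neutral) auto
  then show ?thesis using assms by (simp add: sum.remove[of I i])
qed

text \<open>The meeting point of the proof: cone membership and nonnegativity of the trace form are
  both shown equivalent to this condition on the eigenvalues \<open>lam\<close>.\<close>

definition nonneg_on_sum_zero :: "'a set \<Rightarrow> ('a \<Rightarrow> real) \<Rightarrow> bool" where
  "nonneg_on_sum_zero I lam \<longleftrightarrow>
     (\<forall>y. (\<Sum>i\<in>I. y i) = 0 \<longrightarrow> 0 \<le> (\<Sum>i\<in>I. lam i * (y i)\<^sup>2))"

text \<open>Test with the difference of two unit vectors.\<close>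

lemma nonneg_on_sum_zero_pair:
  assumes "finite I" "nonneg_on_sum_zero I lam" "a \<in> I" "b \<in> I" "a \<noteq> b"
  shows "0 \<le> lam a + lam b"
proof -
  define y where "y i = (if i = a then 1 else 0) - (if i = b then 1 else (0::real))" for i
  have "(\<Sum>i\<in>I. y i) = 0" using assms by (simp add: y_def sum_subtractf)
  then have "0 \<le> (\<Sum>i\<in>I. lam i * (y i)\<^sup>2)" using assms(2) by (auto simp: nonneg_on_sum_zero_def)
  also have "\<dots> = (\<Sum>i\<in>I. (if i = a then lam a else 0) + (if i = b then lam b else 0))"
    using assms(5) by (intro sum.cong) (auto simp: y_def)
  also have "\<dots> = lam a + lam b" using assms by (simp add: sum.distrib)
  finally show ?thesis .
qed

text \<open>A critical point at some \<open>lam a\<close> is a repeated root, which the pair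
  inequality keeps nonnegative. Any other one is a zero of a sum of reciprocals: the imaginary part
  forces it to be real, and the reciprocals then form a test vector.\<close>

lemma complex_root_pderiv_linear_prod_nonneg:
  fixes lam :: "'a \<Rightarrow> real"
  assumes I: "finite I" "I \<noteq> {}" and nn: "nonneg_on_sum_zero I lam"
    and root: "poly (pderiv (\<Prod>i\<in>I. [:complex_of_real (lam i), -1:])) z = 0"
  shows "z \<in> \<real>\<^sub>\<ge>\<^sub>0"
proof (cases "\<exists>a\<in>I. z = lam a")
  case True
  then obtain a where a: "a \<in> I" "z = lam a" by blast
  have "(\<Prod>j\<in>I - {a}. complex_of_real (lam j) - z) = 0"
    using root sum_prod_delete_single[OF I(1) a(1), of "\<lambda>j. complex_of_real (lam j) - z"] a
    by (simp add: pderiv_linear_prod)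
  then obtain b where "b \<in> I" "b \<noteq> a" "lam b = lam a" using I a by auto
  then show ?thesis using nonneg_on_sum_zero_pair[OF I(1) nn a(1), of b] a by simp
next
  case False
  then have nz: "complex_of_real (lam i) - z \<noteq> 0" if "i \<in> I" for i using that by auto
  have s: "(\<Sum>i\<in>I. 1 / (complex_of_real (lam i) - z)) = 0"
    using root sum_prod_delete_eq[OF I(1) nz] nz I by (simp add: pderiv_linear_prod)
  \<comment> \<open>All summands have imaginary parts with the sign of \<open>Im z\<close>, so they
    cancel only if \<open>Im z\<close> is zero.\<close>
  have "Im (1 / (complex_of_real (lam i) - z)) = Im z / (cmod (complex_of_real (lam i) - z))\<^sup>2" for i
    by (simp add: Im_divide cmod_power2)
  then have "Im z * (\<Sum>i\<in>I. 1 / (cmod (complex_of_real (lam i) - z))\<^sup>2) = 0"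
    using arg_cong[OF s, of Im] by (simp add: sum_distrib_left)
  moreover have "(\<Sum>i\<in>I. 1 / (cmod (complex_of_real (lam i) - z))\<^sup>2) > 0"
    using nz I by (intro sum_pos) auto
  ultimately have "Im z = 0" by simp
  then obtain t where t: "z = complex_of_real t" by (metis complex_is_Real_iff Reals_cases)
  have nz': "lam i - t \<noteq> 0" if "i \<in> I" for i using nz[OF that] t by auto
  define y where "y i = 1 / (lam i - t)" for i
  have "complex_of_real (\<Sum>i\<in>I. y i) = 0" using s by (simp add: y_def t)
  then have y0: "(\<Sum>i\<in>I. y i) = 0" by (simp only: of_real_eq_0_iff)
  \<comment> \<open>Split \<open>lam i\<close> as \<open>(lam i - t) + t\<close> and use
    \<open>(lam i - t) * y i = 1\<close>; the linear terms then sum to zero.\<close>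
  have "lam i * (y i)\<^sup>2 = y i + t * (y i)\<^sup>2" if "i \<in> I" for i
  proof -
    have "lam i * (y i)\<^sup>2 = (lam i - t) * y i * y i + t * (y i)\<^sup>2"
      by (simp add: power2_eq_square algebra_simps)
    then show ?thesis using nz'[OF that] by (simp add: y_def)
  qed
  then have "(\<Sum>i\<in>I. lam i * (y i)\<^sup>2) = t * (\<Sum>i\<in>I. (y i)\<^sup>2)"
    using y0 by (simp add: sum.distrib sum_distrib_left)
  then have "0 \<le> t * (\<Sum>i\<in>I. (y i)\<^sup>2)" using nn y0 by (auto simp: nonneg_on_sum_zero_def)
  moreover have "(\<Sum>i\<in>I. (y i)\<^sup>2) > 0"
    using nz' I by (intro sum_pos) (auto simp: y_def)
  ultimately have "0 \<le> t" by (simp add: zero_le_mult_iff)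
  then show ?thesis using t by simp
qed

lemma nonneg_on_sum_zero_if_no_neg_critical_point:
  fixes lam :: "'a \<Rightarrow> real"
  assumes I: "finite I" and no: "\<And>t. t < 0 \<Longrightarrow> poly (pderiv (\<Prod>i\<in>I. [:lam i, -1:])) t \<noteq> 0"
  shows "nonneg_on_sum_zero I lam"
proof (cases "\<forall>i\<in>I. 0 \<le> lam i")
  case True
  then show ?thesis by (auto simp: nonneg_on_sum_zero_def intro!: sum_nonneg)
next
  case False
  then obtain a where a: "a \<in> I" "lam a < 0" by force
  define F where "F = (\<Prod>i\<in>I. [:lam i, -1:])"
  have F0: "poly F (lam i) = 0" if "i \<in> I" for i
    using that I by (auto simp: F_def poly_prod)
  have Fa: "poly (pderiv F) (lam a) = - (\<Prod>j\<in>I - {a}. lam j - lam a)"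
    using sum_prod_delete_single[OF I a(1), of "\<lambda>j. lam j - lam a"]
    by (simp add: F_def pderiv_linear_prod)
  \<comment> \<open>A second \<open>lam b \<le> 0\<close> would make \<open>lam a\<close> a repeated
    root or, by Rolle, put a critical point strictly between \<open>lam a\<close> and
    \<open>lam b\<close>, hence below zero.\<close>
  have pos: "0 < lam b" if b: "b \<in> I - {a}" for b
  proof (rule ccontr)
    assume neg: "\<not> 0 < lam b"
    consider "lam a = lam b" | "lam a < lam b" | "lam b < lam a" by linarith
    then have "\<exists>t<0. poly (pderiv F) t = 0"
    proof cases
      case 1
      have "(\<Prod>j\<in>I - {a}. lam j - lam a) = 0" using 1 b I by (intro prod_zero) auto
      then show ?thesis using Fa a by auto
    next
      case 2
      from poly_MVT[OF 2, of F] F0 a b neg show ?thesis by force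
    next
      case 3
      from poly_MVT[OF 3, of F] F0 a b neg show ?thesis by force
    qed
    then show False using no by (auto simp: F_def)
  qed
  have "0 < (\<Prod>j\<in>I - {a}. lam j - lam a)"
    using pos a by (intro prod_pos) (force intro: less_trans)
  then have neg: "poly (pderiv F) (lam a) < 0" using Fa by simp
  \<comment> \<open>The derivative is negative at \<open>lam a\<close>; if it were positive at 0, it
    would vanish in between.\<close>
  have F0le: "poly (pderiv F) 0 \<le> 0"
  proof (rule ccontr)
    assume "\<not> ?thesis"
    then have "0 < poly (pderiv F) 0" by simp
    from poly_IVT_pos[OF a(2) neg this] no show False by (auto simp: F_def)
  qed
  have nz: "lam i \<noteq> 0" if "i \<in> I" for i using pos a that by (cases "i = a") force+
  \<comment> \<open>At 0 the derivative is minus the product times the sum of reciprocals. Exactly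
    one factor is negative, so the product is negative and the sum of reciprocals is at most
    zero.\<close>
  have "0 \<le> (\<Prod>i\<in>I. lam i) * (\<Sum>i\<in>I. 1 / lam i)"
    using F0le sum_prod_delete_eq[OF I nz] by (simp add: F_def pderiv_linear_prod)
  moreover have "(\<Prod>i\<in>I. lam i) < 0"
  proof -
    have "0 < (\<Prod>i\<in>I - {a}. lam i)" by (intro prod_pos pos)
    then show ?thesis using a I by (simp add: prod.remove[of I a] mult_neg_pos)
  qed
  ultimately have "(\<Sum>i\<in>I. 1 / lam i) \<le> 0" by (simp add: zero_le_mult_iff)
  then have le: "(\<Sum>i\<in>I - {a}. 1 / lam i) \<le> - (1 / lam a)"
    using I a by (simp add: sum.remove[of I a])
  show ?thesis
    unfolding nonneg_on_sum_zero_def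
  proof (intro allI impI)
    fix y :: "'a \<Rightarrow> real" assume y: "(\<Sum>i\<in>I. y i) = 0"
    define S where "S = (\<Sum>i\<in>I - {a}. lam i * (y i)\<^sup>2)"
    have S0: "0 \<le> S" unfolding S_def using pos by (intro sum_nonneg) (force simp: less_imp_le)
    have "y a = - (\<Sum>i\<in>I - {a}. y i)" using y I a by (simp add: sum.remove[of I a])
    then have "(y a)\<^sup>2 = (\<Sum>i\<in>I - {a}. y i)\<^sup>2" by simp
    \<comment> \<open>The weights \<open>sqrt (lam i)\<close> are inserted so that Cauchy-Schwarz
      produces \<open>S\<close> and the sum of reciprocals.\<close>
    also have "\<dots> = (\<Sum>i\<in>I - {a}. sqrt (lam i) * y i * (1 / sqrt (lam i)))\<^sup>2"
    proof -
      have "y i = sqrt (lam i) * y i * (1 / sqrt (lam i))" if "i \<in> I - {a}" for i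
        using pos[OF that] by simp
      then show ?thesis by (metis (no_types, lifting) sum.cong)
    qed
    also have "\<dots> \<le> (\<Sum>i\<in>I - {a}. (sqrt (lam i) * y i)\<^sup>2) * (\<Sum>i\<in>I - {a}. (1 / sqrt (lam i))\<^sup>2)"
      by (rule Cauchy_Schwarz_ineq_sum)
    also have "(\<Sum>i\<in>I - {a}. (sqrt (lam i) * y i)\<^sup>2) = S"
      unfolding S_def using pos by (intro sum.cong) (auto simp: power_mult_distrib less_imp_le)
    also have "(\<Sum>i\<in>I - {a}. (1 / sqrt (lam i))\<^sup>2) = (\<Sum>i\<in>I - {a}. 1 / lam i)"
      using pos by (intro sum.cong) (auto simp: power_divide less_imp_le)
    also have "S * (\<Sum>i\<in>I - {a}. 1 / lam i) \<le> S * (- (1 / lam a))"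
      using le S0 by (rule mult_left_mono)
    finally have "(y a)\<^sup>2 \<le> S / (- lam a)" by simp
    then have "(y a)\<^sup>2 * (- lam a) \<le> S" using a by (subst (asm) pos_le_divide_eq) auto
    then show "0 \<le> (\<Sum>i\<in>I. lam i * (y i)\<^sup>2)"
      using I a by (simp add: sum.remove[of I a] S_def mult.commute)
  qed
qed

lemma pderiv_linear_prod_roots_nonneg_iff:
  fixes lam :: "'a \<Rightarrow> real"
  assumes I: "finite I" "I \<noteq> {}"
  shows "{z. poly (map_poly complex_of_real (pderiv (\<Prod>i\<in>I. [:lam i, -1:]))) z = 0} \<subseteq> \<real>\<^sub>\<ge>\<^sub>0
    \<longleftrightarrow> nonneg_on_sum_zero I lam"
proof
  assume roots: "{z. poly (map_poly complex_of_real (pderiv (\<Prod>i\<in>I. [:lam i, -1:]))) z = 0} \<subseteq> \<real>\<^sub>\<ge>\<^sub>0"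
  show "nonneg_on_sum_zero I lam"
  proof (rule nonneg_on_sum_zero_if_no_neg_critical_point[OF I(1)])
    fix t :: real assume t: "t < 0"
    show "poly (pderiv (\<Prod>i\<in>I. [:lam i, -1:])) t \<noteq> 0"
    proof
      assume "poly (pderiv (\<Prod>i\<in>I. [:lam i, -1:])) t = 0"
      then have "poly (map_poly complex_of_real (pderiv (\<Prod>i\<in>I. [:lam i, -1:]))) (complex_of_real t) = 0"
        by (simp only: of_real_hom.poly_map_poly of_real_0)
      then have "complex_of_real t \<in> \<real>\<^sub>\<ge>\<^sub>0" using roots by blast
      then show False using t by simp
    qed
  qed
next
  assume "nonneg_on_sum_zero I lam"
  then show "{z. poly (map_poly complex_of_real (pderiv (\<Prod>i\<in>I. [:lam i, -1:]))) z = 0} \<subseteq> \<real>\<^sub>\<ge>\<^sub>0"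
    using complex_root_pderiv_linear_prod_nonneg[OF I] by (auto simp: map_poly_pderiv_linear_prod)
qed

text \<open>Averaging with the transposed sum replaces \<open>lam i\<close> by the mean of
  \<open>lam i\<close> and \<open>lam j\<close>. The diagonal part is then covered by
  \<open>nn\<close>, and the off-diagonal coefficients are nonnegative by the pair
  inequality.\<close>

lemma nonneg_on_sum_zero_sym_array:
  fixes z :: "'a \<Rightarrow> 'a \<Rightarrow> real"
  assumes I: "finite I" and nn: "nonneg_on_sum_zero I lam"
    and sym: "\<And>i j. i \<in> I \<Longrightarrow> j \<in> I \<Longrightarrow> z i j = z j i" and tr: "(\<Sum>i\<in>I. z i i) = 0"
  shows "0 \<le> (\<Sum>i\<in>I. \<Sum>j\<in>I. lam i * (z i j)\<^sup>2)"
proof -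
  let ?S = "\<Sum>i\<in>I. \<Sum>j\<in>I. lam i * (z i j)\<^sup>2"
  have "?S = (\<Sum>i\<in>I. \<Sum>j\<in>I. lam j * (z i j)\<^sup>2)"
    by (subst sum.swap) (auto simp: sym intro!: sum.cong)
  then have "2 * ?S = (\<Sum>i\<in>I. \<Sum>j\<in>I. (lam i + lam j) * (z i j)\<^sup>2)"
    by (simp add: sum.distrib distrib_right)
  also have "\<dots> = (\<Sum>i\<in>I. \<Sum>j\<in>I. (if j = i then 2 * lam i * (z i i)\<^sup>2 else 0)
      + (if j = i then 0 else (lam i + lam j) * (z i j)\<^sup>2))"
    by (intro sum.cong) auto
  also have "\<dots> = 2 * (\<Sum>i\<in>I. lam i * (z i i)\<^sup>2)
      + (\<Sum>i\<in>I. \<Sum>j\<in>I. if j = i then 0 else (lam i + lam j) * (z i j)\<^sup>2)"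
    using I by (simp add: sum.distrib sum_distrib_left mult.assoc)
  also have "\<dots> \<ge> 0"
  proof (rule add_nonneg_nonneg)
    show "0 \<le> 2 * (\<Sum>i\<in>I. lam i * (z i i)\<^sup>2)" using nn tr by (simp add: nonneg_on_sum_zero_def)
    show "0 \<le> (\<Sum>i\<in>I. \<Sum>j\<in>I. if j = i then 0 else (lam i + lam j) * (z i j)\<^sup>2)"
      using nonneg_on_sum_zero_pair[OF I nn] by (intro sum_nonneg) simp
  qed
  finally show ?thesis by simp
qed

subsection \<open>The trace form\<close>

definition mat_trace :: "real mat \<Rightarrow> real" where
  "mat_trace M = (\<Sum>i<dim_row M. M $$ (i, i))"

lemma mat_trace_mult:
  assumes "L \<in> carrier_mat n n" "R \<in> carrier_mat n n"
  shows "mat_trace (L * R) = (\<Sum>i<n. \<Sum>j<n. L $$ (i, j) * R $$ (j, i))"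
  using assms by (simp add: mat_trace_def scalar_prod_def atLeast0LessThan)

lemma mat_trace_mult_commute:
  assumes "L \<in> carrier_mat n n" "R \<in> carrier_mat n n"
  shows "mat_trace (L * R) = mat_trace (R * L)"
  using assms by (simp add: mat_trace_mult[of _ n]) (subst sum.swap, simp add: mult.commute)

lemma mat_trace_transpose: "M \<in> carrier_mat n n \<Longrightarrow> mat_trace (transpose_mat M) = mat_trace M"
  by (simp add: mat_trace_def)

text \<open>The index set is arbitrary because the same notion serves for pencils, for expansions in
  symmetric units and for the spanning family.\<close>

definition mat_lincomb :: "nat \<Rightarrow> 'm set \<Rightarrow> ('m \<Rightarrow> real) \<Rightarrow> ('m \<Rightarrow> real mat) \<Rightarrow> real mat" where
  "mat_lincomb n S c F = mat n n (\<lambda>(i, j). \<Sum>m\<in>S. c m * F m $$ (i, j))"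

lemma mat_lincomb_carrier [simp]: "mat_lincomb n S c F \<in> carrier_mat n n"
  by (simp add: mat_lincomb_def)

lemma mat_trace_lincomb_mult:
  assumes "\<And>m. m \<in> S \<Longrightarrow> F m \<in> carrier_mat n n" "R \<in> carrier_mat n n"
  shows "mat_trace (mat_lincomb n S c F * R) = (\<Sum>m\<in>S. c m * mat_trace (F m * R))"
proof -
  have "mat_trace (mat_lincomb n S c F * R) =
      (\<Sum>i<n. \<Sum>j<n. \<Sum>m\<in>S. c m * F m $$ (i, j) * R $$ (j, i))"
    using assms(2) by (subst mat_trace_mult[of _ n])
      (auto simp: mat_lincomb_def sum_distrib_right intro!: sum.cong)
  also have "\<dots> = (\<Sum>i<n. \<Sum>m\<in>S. \<Sum>j<n. c m * F m $$ (i, j) * R $$ (j, i))"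
    by (intro sum.cong refl) (rule sum.swap)
  also have "\<dots> = (\<Sum>m\<in>S. \<Sum>i<n. \<Sum>j<n. c m * F m $$ (i, j) * R $$ (j, i))"
    by (rule sum.swap)
  also have "\<dots> = (\<Sum>m\<in>S. c m * mat_trace (F m * R))"
    using assms by (auto simp: mat_trace_mult[of _ n] sum_distrib_left mult.assoc intro!: sum.cong)
  finally show ?thesis .
qed

lemma sym_mat_entry:
  assumes "sym_mat n M" "i < n" "j < n"
  shows "M $$ (i, j) = M $$ (j, i)"
proof -
  have "M \<in> carrier_mat n n" "transpose_mat M = M" using assms by (auto simp: sym_mat_def)
  then show ?thesis using assms by (metis carrier_matD index_transpose_mat(1))
qed

lemma sym_mat_lincomb:
  assumes "\<And>m. m \<in> S \<Longrightarrow> sym_mat n (F m)"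
  shows "sym_mat n (mat_lincomb n S c F)"
  using sym_mat_entry[OF assms] by (auto simp: sym_mat_def mat_lincomb_def intro!: eq_matI sum.cong)

lemma lin_pencil_eq_lincomb: "lin_pencil n A x = mat_lincomb n UNIV (vec_nth x) A"
  by (simp add: lin_pencil_def mat_lincomb_def mult.commute)

text \<open>For symmetric arguments this is the polarization of the quadratic form
  \<open>tr (X Y G Y)\<close> in \<open>Y\<close>.\<close>

definition trace_form :: "real mat \<Rightarrow> real mat \<Rightarrow> real mat \<Rightarrow> real mat \<Rightarrow> real" where
  "trace_form G X Y Z = mat_trace (X * (Y * (G * Z)))"

definition trace_orthogonal :: "nat \<Rightarrow> real mat \<Rightarrow> real mat set" where
  "trace_orthogonal n G = {Y. sym_mat n Y \<and> mat_trace (G * Y) = 0}"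

context
  fixes n :: nat and G :: "real mat"
  assumes G: "G \<in> carrier_mat n n"
begin

text \<open>Cyclic invariance moves the second or third argument to the front, where linearity of
  the trace applies.\<close>

lemma trace_form_rotate:
  assumes "X \<in> carrier_mat n n" "Y \<in> carrier_mat n n" "Z \<in> carrier_mat n n"
  shows "trace_form G X Y Z = mat_trace (Y * (G * (Z * X)))"
    and "trace_form G X Y Z = mat_trace (Z * (X * (Y * G)))"
proof -
  have "trace_form G X Y Z = mat_trace ((Y * (G * Z)) * X)"
    unfolding trace_form_def by (rule mat_trace_mult_commute[of _ n]) (use assms G in auto)
  then show "trace_form G X Y Z = mat_trace (Y * (G * (Z * X)))"
    using assms G by (simp add: assoc_mult_mat[of _ n n _ n _ n])
  have "trace_form G X Y Z = mat_trace ((X * (Y * G)) * Z)"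
    using assms G by (simp add: trace_form_def assoc_mult_mat[of _ n n _ n _ n])
  also have "\<dots> = mat_trace (Z * (X * (Y * G)))"
    by (rule mat_trace_mult_commute[of _ n]) (use assms G in auto)
  finally show "trace_form G X Y Z = mat_trace (Z * (X * (Y * G)))" .
qed

text \<open>Transposition reverses the product of symmetric factors; a cyclic rotation restores its
  shape with \<open>Y\<close> and \<open>Z\<close> exchanged.\<close>

lemma trace_form_commute:
  assumes "sym_mat n G" "sym_mat n X" "sym_mat n Y" "sym_mat n Z"
  shows "trace_form G X Y Z = trace_form G X Z Y"
proof -
  have c: "X \<in> carrier_mat n n" "Y \<in> carrier_mat n n" "Z \<in> carrier_mat n n"
    and t: "transpose_mat G = G" "transpose_mat X = X" "transpose_mat Y = Y" "transpose_mat Z = Z"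
    using assms by (auto simp: sym_mat_def)
  have "trace_form G X Y Z = mat_trace (transpose_mat (X * (Y * (G * Z))))"
    unfolding trace_form_def by (rule mat_trace_transpose[of _ n, symmetric]) (use c G in auto)
  also have "transpose_mat (X * (Y * (G * Z))) = Z * (G * (Y * X))"
    using c G t by (simp add: transpose_mult[of _ n n _ n] assoc_mult_mat[of _ n n _ n _ n])
  also have "mat_trace \<dots> = trace_form G X Z Y"
    using trace_form_rotate(1)[OF c(1,3,2)] by simp
  finally show ?thesis .
qed

lemma trace_form_lincomb:
  assumes "\<And>m. m \<in> S \<Longrightarrow> F m \<in> carrier_mat n n"
    and c: "Y \<in> carrier_mat n n" "Z \<in> carrier_mat n n"
  shows "trace_form G (mat_lincomb n S c F) Y Z = (\<Sum>m\<in>S. c m * trace_form G (F m) Y Z)"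
    and "trace_form G Y (mat_lincomb n S c F) Z = (\<Sum>m\<in>S. c m * trace_form G Y (F m) Z)"
    and "trace_form G Y Z (mat_lincomb n S c F) = (\<Sum>m\<in>S. c m * trace_form G Y Z (F m))"
proof -
  show "trace_form G (mat_lincomb n S c F) Y Z = (\<Sum>m\<in>S. c m * trace_form G (F m) Y Z)"
    unfolding trace_form_def by (rule mat_trace_lincomb_mult) (use assms G in auto)
  have "trace_form G Y (mat_lincomb n S c F) Z = (\<Sum>m\<in>S. c m * mat_trace (F m * (G * (Z * Y))))"
    by (subst trace_form_rotate(1), use assms in simp_all)
      (rule mat_trace_lincomb_mult, use assms G in auto)
  then show "trace_form G Y (mat_lincomb n S c F) Z = (\<Sum>m\<in>S. c m * trace_form G Y (F m) Z)"
    using trace_form_rotate(1)[OF c(1) assms(1) c(2)] by simp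
  have "trace_form G Y Z (mat_lincomb n S c F) = (\<Sum>m\<in>S. c m * mat_trace (F m * (Y * (Z * G))))"
    by (subst trace_form_rotate(2), use assms in simp_all)
      (rule mat_trace_lincomb_mult, use assms G in auto)
  then show "trace_form G Y Z (mat_lincomb n S c F) = (\<Sum>m\<in>S. c m * trace_form G Y Z (F m))"
    using trace_form_rotate(2)[OF c assms(1)] by simp
qed

end

section \<open>Symmetric units and a spanning family of the right length\<close>

definition sym_unit :: "nat \<Rightarrow> nat \<times> nat \<Rightarrow> real mat" where
  "sym_unit n \<tau> = mat n n (\<lambda>(i, j). if (min i j, max i j) = \<tau> then 1 else 0)"

lemma sym_unit_carrier [simp]: "sym_unit n \<tau> \<in> carrier_mat n n"
  by (simp add: sym_unit_def)

lemma sym_mat_sym_unit: "sym_mat n (sym_unit n \<tau>)"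
  by (auto simp: sym_mat_def sym_unit_def min.commute max.commute intro!: eq_matI)

definition upper_pairs :: "nat \<Rightarrow> (nat \<times> nat) set" where
  "upper_pairs n = {(i, j). i \<le> j \<and> j < n}"

lemma finite_upper_pairs [simp]: "finite (upper_pairs n)"
proof -
  have "upper_pairs n \<subseteq> {..<n} \<times> {..<n}" by (auto simp: upper_pairs_def)
  then show ?thesis by (rule finite_subset) simp
qed

lemma card_upper_pairs: "card (upper_pairs n) = (n + 1) choose 2"
proof -
  \<comment> \<open>Group by the larger index: \<open>j\<close> occurs with the \<open>Suc j\<close>
    values up to \<open>j\<close> itself.\<close>
  have "bij_betw (\<lambda>(i, j). (j, i)) (upper_pairs n) (SIGMA j:{..<n}. {..j})"
    by (rule bij_betwI[of _ _ _ "\<lambda>(i, j). (j, i)"]) (auto simp: upper_pairs_def)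
  then have "card (upper_pairs n) = (\<Sum>j<n. Suc j)"
    by (simp add: bij_betw_same_card)
  also have "\<dots> = (n + 1) choose 2"
    by (induction n) (simp_all add: choose_two numeral_2_eq_2)
  finally show ?thesis .
qed

lemma sym_mat_eq_lincomb_sym_unit:
  assumes "sym_mat n Y"
  shows "Y = mat_lincomb n (upper_pairs n) (\<lambda>\<tau>. Y $$ \<tau>) (sym_unit n)"
proof (rule eq_matI)
  fix i j
  assume "i < dim_row (mat_lincomb n (upper_pairs n) (\<lambda>\<tau>. Y $$ \<tau>) (sym_unit n))"
    and "j < dim_col (mat_lincomb n (upper_pairs n) (\<lambda>\<tau>. Y $$ \<tau>) (sym_unit n))"
  then have ij: "i < n" "j < n" by (simp_all add: mat_lincomb_def)
  have "(\<Sum>\<tau>\<in>upper_pairs n. Y $$ \<tau> * sym_unit n \<tau> $$ (i, j)) =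
      (\<Sum>\<tau>\<in>upper_pairs n. if \<tau> = (min i j, max i j) then Y $$ (min i j, max i j) else 0)"
    using ij by (intro sum.cong) (auto simp: sym_unit_def)
  also have "\<dots> = Y $$ (min i j, max i j)"
    using ij by (subst sum.delta[OF finite_upper_pairs]) (auto simp: upper_pairs_def)
  also have "\<dots> = Y $$ (i, j)"
  proof (cases "i \<le> j")
    case False
    then show ?thesis using sym_mat_entry[OF assms ij] by (simp add: min_def max_def)
  qed (simp add: min_def max_def)
  finally show "Y $$ (i, j) = mat_lincomb n (upper_pairs n) (\<lambda>\<tau>. Y $$ \<tau>) (sym_unit n) $$ (i, j)"
    using ij by (simp add: mat_lincomb_def)
qed (use assms in \<open>auto simp: sym_mat_def mat_lincomb_def\<close>)

lemma trace_orthogonal_spanning: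
  assumes n: "0 < n" and G: "pd_mat n G"
  obtains B :: "nat \<Rightarrow> real mat" where
    "\<And>m. B m \<in> trace_orthogonal n G"
    "\<And>Y. Y \<in> trace_orthogonal n G \<Longrightarrow>
      \<exists>c. Y = mat_lincomb n {..<((n + 1) choose 2) - 1} c B"
proof -
  have Gc: "G \<in> carrier_mat n n" using G by (simp add: pd_mat_def sym_mat_def)
  define o0 where "o0 = (0 :: nat, 0 :: nat)"
  define T where "T = upper_pairs n - {o0}"
  have oU: "o0 \<in> upper_pairs n" using n by (simp add: o0_def upper_pairs_def)
  have T: "finite T" "card T = ((n + 1) choose 2) - 1"
    using oU by (simp_all add: T_def card_upper_pairs)
  define g where "g \<tau> = mat_trace (sym_unit n \<tau> * G)" for \<tau>
  have "g o0 = G $$ (0, 0)"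
  proof -
    have "g o0 = (\<Sum>i<n. \<Sum>j<n. if j = 0 then (if i = 0 then G $$ (0, 0) else 0) else 0)"
      unfolding g_def mat_trace_mult[OF sym_unit_carrier Gc]
      by (intro sum.cong) (auto simp: sym_unit_def o0_def)
    then show ?thesis using n by simp
  qed
  moreover have "0 < G $$ (0, 0)"
  proof -
    have "0 < unit_vec n 0 \<bullet> (G *\<^sub>v unit_vec n 0)"
      using n by (intro pd_mat_form_pos[OF G]) (auto simp: unit_vec_nonzero)
    then show ?thesis using n Gc by (simp add: scalar_prod_left_unit)
  qed
  ultimately have go: "0 < g o0" by simp
  (* subtract a multiple of the unit at (0, 0) to reach trace zero against G *)
  define B' where "B' \<tau> = mat_lincomb n {True, False} (\<lambda>b. if b then 1 else - g \<tau> / g o0)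
      (\<lambda>b. if b then sym_unit n \<tau> else sym_unit n o0)" for \<tau>
  have B'_entry: "B' \<tau> $$ (i, j) = sym_unit n \<tau> $$ (i, j) - g \<tau> / g o0 * sym_unit n o0 $$ (i, j)"
    if "i < n" "j < n" for \<tau> i j
    using that by (simp add: B'_def mat_lincomb_def)
  have B': "B' \<tau> \<in> trace_orthogonal n G" for \<tau>
  proof -
    have "mat_trace (G * B' \<tau>) = mat_trace (B' \<tau> * G)"
      by (rule mat_trace_mult_commute[OF Gc]) (simp add: B'_def)
    also have "\<dots> = 0"
      unfolding B'_def using Gc go by (subst mat_trace_lincomb_mult) (auto simp: g_def[symmetric])
    finally show ?thesis
      by (auto simp: trace_orthogonal_def B'_def intro!: sym_mat_lincomb sym_mat_sym_unit)
  qed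
  \<comment> \<open>The coefficients are the upper entries of \<open>Y\<close> apart from the
    corner; by the trace condition the corrections in \<open>B'\<close> add up to the corner
    entry.\<close>
  have span: "Y = mat_lincomb n T (\<lambda>\<tau>. Y $$ \<tau>) B'" if Y: "Y \<in> trace_orthogonal n G" for Y
  proof -
    have Ys: "sym_mat n Y" and Yc: "Y \<in> carrier_mat n n" and "mat_trace (G * Y) = 0"
      using Y by (auto simp: trace_orthogonal_def sym_mat_def)
    then have "mat_trace (Y * G) = 0" using mat_trace_mult_commute[OF Yc Gc] by simp
    then have "(\<Sum>\<tau>\<in>upper_pairs n. Y $$ \<tau> * g \<tau>) = 0"
      by (subst (asm) sym_mat_eq_lincomb_sym_unit[OF Ys], subst (asm) mat_trace_lincomb_mult)
        (use Gc in \<open>auto simp: g_def\<close>)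
    then have "Y $$ o0 * g o0 + (\<Sum>\<tau>\<in>T. Y $$ \<tau> * g \<tau>) = 0"
      using oU by (simp add: T_def sum.remove[of "upper_pairs n" o0])
    then have Yo: "Y $$ o0 = - (\<Sum>\<tau>\<in>T. Y $$ \<tau> * g \<tau>) / g o0"
      using go by (simp add: field_simps)
    show ?thesis
    proof (rule eq_matI)
      fix i j
      assume "i < dim_row (mat_lincomb n T (\<lambda>\<tau>. Y $$ \<tau>) B')"
        and "j < dim_col (mat_lincomb n T (\<lambda>\<tau>. Y $$ \<tau>) B')"
      then have ij: "i < n" "j < n" by (simp_all add: mat_lincomb_def)
      have "mat_lincomb n T (\<lambda>\<tau>. Y $$ \<tau>) B' $$ (i, j) =
          (\<Sum>\<tau>\<in>T. Y $$ \<tau> * sym_unit n \<tau> $$ (i, j) - Y $$ \<tau> * g \<tau> / g o0 * sym_unit n o0 $$ (i, j))"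
        using ij by (simp add: mat_lincomb_def B'_entry algebra_simps)
      also have "\<dots> = (\<Sum>\<tau>\<in>T. Y $$ \<tau> * sym_unit n \<tau> $$ (i, j)) + Y $$ o0 * sym_unit n o0 $$ (i, j)"
        unfolding Yo by (simp add: sum_subtractf sum_distrib_right sum_divide_distrib)
      also have "\<dots> = (\<Sum>\<tau>\<in>upper_pairs n. Y $$ \<tau> * sym_unit n \<tau> $$ (i, j))"
        using oU by (simp add: T_def sum.remove[of "upper_pairs n" o0])
      also have "\<dots> = mat_lincomb n (upper_pairs n) (\<lambda>\<tau>. Y $$ \<tau>) (sym_unit n) $$ (i, j)"
        using ij by (simp add: mat_lincomb_def)
      also have "\<dots> = Y $$ (i, j)" using sym_mat_eq_lincomb_sym_unit[OF Ys] by simp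
      finally show "Y $$ (i, j) = mat_lincomb n T (\<lambda>\<tau>. Y $$ \<tau>) B' $$ (i, j)" by simp
    qed (use Yc in \<open>auto simp: mat_lincomb_def\<close>)
  qed
  obtain h where h: "bij_betw h {..<((n + 1) choose 2) - 1} T"
    using ex_bij_betw_nat_finite[OF T(1)] T(2) by (auto simp: atLeast0LessThan)
  show ?thesis
  proof
    show "B' (h m) \<in> trace_orthogonal n G" for m by (rule B')
    show "\<exists>c. Y = mat_lincomb n {..<((n + 1) choose 2) - 1} c (\<lambda>m. B' (h m))"
      if "Y \<in> trace_orthogonal n G" for Y
    proof
      show "Y = mat_lincomb n {..<((n + 1) choose 2) - 1} (\<lambda>m. Y $$ h m) (\<lambda>m. B' (h m))"
        unfolding mat_lincomb_def
        using span[OF that, unfolded mat_lincomb_def]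
          sum.reindex_bij_betw[OF h, of "\<lambda>\<tau>. Y $$ \<tau> * B' \<tau> $$ ij" for ij]
        by simp
    qed
  qed
qed

text \<open>The congruence \<open>Y = P * Z * transpose_mat P\<close> carries trace-zero symmetric
  \<open>Z\<close> to \<open>trace_orthogonal n G\<close>, and \<open>PGP\<close> cancels the inner
  \<open>G\<close>. One direction tests with diagonal \<open>Z\<close>; the other pulls
  \<open>Y\<close> back to a symmetric array.\<close>

lemma trace_form_nonneg_iff:
  assumes P: "P \<in> carrier_mat n n" and G: "sym_mat n G" and X: "sym_mat n X"
    and PGP: "transpose_mat P * (G * P) = 1\<^sub>m n"
    and PXP: "transpose_mat P * (X * P) = mat_diag n lam"
  shows "(\<forall>Y\<in>trace_orthogonal n G. 0 \<le> trace_form G X Y Y) \<longleftrightarrow> nonneg_on_sum_zero {..<n} lam"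
proof -
  note assoc = assoc_mult_mat[of _ n n _ n _ n]
  have Gc: "G \<in> carrier_mat n n" and Gt: "transpose_mat G = G" and Xc: "X \<in> carrier_mat n n"
    using G X by (auto simp: sym_mat_def)
  have Pt: "transpose_mat P \<in> carrier_mat n n" using P by simp
  have congr: "mat_trace (G * (P * Z * transpose_mat P)) = mat_trace Z"
    "trace_form G X (P * Z * transpose_mat P) (P * Z * transpose_mat P) = mat_trace (mat_diag n lam * (Z * Z))"
    if Z: "Z \<in> carrier_mat n n" for Z
  proof -
    have PGPW: "transpose_mat P * (G * (P * W)) = W" if "W \<in> carrier_mat n n" for W
    proof -
      have "transpose_mat P * (G * (P * W)) = transpose_mat P * (G * P) * W"
        using that P Gc by (simp add: assoc)
      then show ?thesis using that PGP by simp
    qed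
    have "mat_trace (G * (P * Z * transpose_mat P)) = mat_trace (G * (P * Z) * transpose_mat P)"
      using Z P Gc by (simp add: assoc)
    also have "\<dots> = mat_trace (transpose_mat P * (G * (P * Z)))"
      by (rule mat_trace_mult_commute[of _ n]) (use Z P Gc in auto)
    finally show "mat_trace (G * (P * Z * transpose_mat P)) = mat_trace Z"
      using PGPW[OF Z] by simp
    have "trace_form G X (P * Z * transpose_mat P) (P * Z * transpose_mat P) =
        mat_trace (X * (P * (Z * Z)) * transpose_mat P)"
      unfolding trace_form_def using Z P Gc Xc by (simp add: assoc PGPW)
    also have "\<dots> = mat_trace (transpose_mat P * (X * (P * (Z * Z))))"
      by (rule mat_trace_mult_commute[of _ n]) (use Z P Xc in auto)
    also have "transpose_mat P * (X * (P * (Z * Z))) = transpose_mat P * (X * P) * (Z * Z)"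
      using Z P Xc by (simp add: assoc)
    finally show "trace_form G X (P * Z * transpose_mat P) (P * Z * transpose_mat P) =
        mat_trace (mat_diag n lam * (Z * Z))" by (simp add: PXP)
  qed
  have diag: "mat_trace (mat_diag n lam * (Z * Z)) = (\<Sum>i<n. \<Sum>j<n. lam i * (Z $$ (i, j))\<^sup>2)"
    if Z: "sym_mat n Z" for Z
  proof -
    have Zc: "Z \<in> carrier_mat n n" using Z by (simp add: sym_mat_def)
    then have "mat_trace (mat_diag n lam * (Z * Z)) = (\<Sum>i<n. lam i * (Z * Z) $$ (i, i))"
      by (simp add: mat_trace_def mat_diag_mult_left[of _ n n])
    also have "\<dots> = (\<Sum>i<n. lam i * (\<Sum>j<n. Z $$ (i, j) * Z $$ (j, i)))"
      using Zc by (simp add: scalar_prod_def atLeast0LessThan)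
    also have "\<dots> = (\<Sum>i<n. \<Sum>j<n. lam i * (Z $$ (i, j))\<^sup>2)"
      by (auto simp: sum_distrib_left power2_eq_square sym_mat_entry[OF Z] intro!: sum.cong)
    finally show ?thesis .
  qed
  show ?thesis
  proof
    assume *: "\<forall>Y\<in>trace_orthogonal n G. 0 \<le> trace_form G X Y Y"
    show "nonneg_on_sum_zero {..<n} lam"
      unfolding nonneg_on_sum_zero_def
    proof (intro allI impI)
      fix y :: "nat \<Rightarrow> real" assume y: "(\<Sum>i<n. y i) = 0"
      define Z where "Z = mat_diag n y"
      have Z: "sym_mat n Z" by (auto simp: Z_def sym_mat_def mat_diag_def intro!: eq_matI)
      then have Zc: "Z \<in> carrier_mat n n" and Zt: "transpose_mat Z = Z" by (auto simp: sym_mat_def)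
      have "transpose_mat (P * Z * transpose_mat P) = P * Z * transpose_mat P"
        using P Zc Zt by (simp add: transpose_mult[of _ n n _ n] assoc)
      moreover have "mat_trace Z = 0" using y by (simp add: mat_trace_def Z_def mat_diag_def)
      ultimately have "P * Z * transpose_mat P \<in> trace_orthogonal n G"
        using P Zc congr(1)[OF Zc] by (simp add: trace_orthogonal_def sym_mat_def)
      then have "0 \<le> (\<Sum>i<n. \<Sum>j<n. lam i * (Z $$ (i, j))\<^sup>2)"
        using * congr(2)[OF Zc] diag[OF Z] by auto
      also have "\<dots> = (\<Sum>i<n. \<Sum>j<n. if j = i then lam i * (y i)\<^sup>2 else 0)"
        by (intro sum.cong) (auto simp: Z_def mat_diag_def)
      also have "\<dots> = (\<Sum>i<n. lam i * (y i)\<^sup>2)" by simp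
      finally show "0 \<le> (\<Sum>i<n. lam i * (y i)\<^sup>2)" .
    qed
  next
    assume nn: "nonneg_on_sum_zero {..<n} lam"
    show "\<forall>Y\<in>trace_orthogonal n G. 0 \<le> trace_form G X Y Y"
    proof
      fix Y assume "Y \<in> trace_orthogonal n G"
      then have Yc: "Y \<in> carrier_mat n n" and Yt: "transpose_mat Y = Y" and Y0: "mat_trace (G * Y) = 0"
        by (auto simp: trace_orthogonal_def sym_mat_def)
      \<comment> \<open>By \<open>PGP\<close> the inverse of \<open>P\<close> is
        \<open>transpose_mat P * G\<close>, so this is the preimage of \<open>Y\<close> under the
        congruence.\<close>
      define Z where "Z = transpose_mat P * (G * (Y * (G * P)))"
      have Z: "sym_mat n Z"
        using P Gc Gt Yc Yt by (simp add: Z_def sym_mat_def transpose_mult[of _ n n _ n] assoc)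
      then have Zc: "Z \<in> carrier_mat n n" and Zt: "transpose_mat Z = Z" by (auto simp: sym_mat_def)
      have "P * (transpose_mat P * G) = 1\<^sub>m n"
        by (rule mat_mult_left_right_inverse) (use P Gc PGP in \<open>auto simp: assoc\<close>)
      then have 1: "P * (transpose_mat P * (G * W)) = W" if "W \<in> carrier_mat n n" for W
        using that P Gc assoc[of P "transpose_mat P * G" W] by (simp add: assoc)
      have 2: "G * (P * transpose_mat P) = 1\<^sub>m n"
        using mat_mult_left_right_inverse[OF Pt _ PGP] P Gc by (simp add: assoc)
      have "P * Z * transpose_mat P = P * (transpose_mat P * (G * (Y * (G * (P * transpose_mat P)))))"
        using P Gc Yc by (simp add: Z_def assoc)
      also have "\<dots> = Y" using Yc 1[OF Yc] by (simp add: 2)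
      finally have YZ: "P * Z * transpose_mat P = Y" .
      have "(\<Sum>i<n. Z $$ (i, i)) = 0"
        using congr(1)[OF Zc] Y0 Zc by (simp add: YZ mat_trace_def)
      then have "0 \<le> (\<Sum>i<n. \<Sum>j<n. lam i * (Z $$ (i, j))\<^sup>2)"
        by (intro nonneg_on_sum_zero_sym_array nn) (auto simp: sym_mat_entry[OF Z])
      then show "0 \<le> trace_form G X Y Y"
        using congr(2)[OF Zc] diag[OF Z] by (simp add: YZ)
    qed
  qed
qed

subsection \<open>The hyperbolicity cone of the derivative\<close>

text \<open>Congruence by \<open>P\<close> makes the pencil along the line diagonal with entries
  \<open>lam i - t\<close>, so \<open>p\<close> on the line is a nonzero multiple of
  \<open>F\<close>. The roots of its directional derivative are therefore the critical points of
  \<open>F\<close>.\<close>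

lemma hyperbolicity_cone_dir_deriv_iff:
  fixes A :: "'n::finite \<Rightarrow> real mat" and e x :: "real ^ 'n"
  assumes l: "0 < l" and A: "\<And>k. sym_mat l (A k)"
    and P: "P \<in> carrier_mat l l"
    and PGP: "transpose_mat P * (lin_pencil l A e * P) = 1\<^sub>m l"
    and PXP: "transpose_mat P * (lin_pencil l A x * P) = mat_diag l lam"
    and p: "\<And>x. p x = Determinant.det (lin_pencil l A x)"
  shows "x \<in> hyperbolicity_cone (dir_deriv e p) e \<longleftrightarrow> nonneg_on_sum_zero {..<l} lam"
proof -
  define G where "G = lin_pencil l A e"
  define X where "X = lin_pencil l A x"
  have Gc: "G \<in> carrier_mat l l" and Xc: "X \<in> carrier_mat l l"
    by (simp_all add: G_def X_def lin_pencil_def)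
  define F where "F = (\<Prod>i<l. [:lam i, -1:])"
  define d where "d = Determinant.det P ^ 2"
  have det_congr: "Determinant.det (transpose_mat P * (M * P)) = d * Determinant.det M"
      if "M \<in> carrier_mat l l" for M
      using P that by (simp add: det_mult[of _ l] det_transpose d_def power2_eq_square)
  have d: "d \<noteq> 0" using det_congr[OF Gc] PGP by (auto simp: G_def)
  have line: "p (x - t *\<^sub>R e) = poly (Polynomial.smult (1 / d) F) t" for t
  proof -
    have pencil: "lin_pencil l A (x - t *\<^sub>R e) = X + (- t) \<cdot>\<^sub>m G"
      by (intro eq_matI) (auto simp: lin_pencil_def X_def G_def algebra_simps sum_subtractf
          sum_distrib_left sum_negf)
    have "d * p (x - t *\<^sub>R e) = Determinant.det (transpose_mat P * ((X + (- t) \<cdot>\<^sub>m G) * P))"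
      unfolding p pencil by (rule det_congr[symmetric]) (use Gc Xc in auto)
    also have "(X + (- t) \<cdot>\<^sub>m G) * P = X * P + (- t) \<cdot>\<^sub>m (G * P)"
      using P Gc Xc by (subst add_mult_distrib_mat[of _ l l]) (auto simp: mult_smult_assoc_mat)
    also have "transpose_mat P * (X * P + (- t) \<cdot>\<^sub>m (G * P)) =
        transpose_mat P * (X * P) + (- t) \<cdot>\<^sub>m (transpose_mat P * (G * P))"
      using P Gc Xc by (subst mult_add_distrib_mat[of _ l l]) (auto simp: mult_smult_distrib)
    also have "\<dots> = mat_diag l (\<lambda>i. lam i - t)"
      using PGP PXP by (auto simp: G_def X_def mat_diag_def intro!: eq_matI)
    also have "Determinant.det \<dots> = prod_list (diag_mat (mat_diag l (\<lambda>i. lam i - t)))"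
      by (rule det_upper_triangular[of _ l]) (auto simp: mat_diag_def upper_triangular_def)
    also have "\<dots> = poly F t"
      by (auto simp: prod_list_diag_prod F_def poly_prod mat_diag_def atLeast0LessThan intro!: prod.cong)
    finally show ?thesis using d by (simp add: field_simps)
  qed
  \<comment> \<open>Moving by \<open>s\<close> along \<open>e\<close> changes the line parameter
    from \<open>t\<close> to \<open>t - s\<close>, hence the minus sign.\<close>
  have dline: "dir_deriv e p (x - t *\<^sub>R e) = poly (- pderiv (Polynomial.smult (1 / d) F)) t" for t
  proof -
    have "x - t *\<^sub>R e + s *\<^sub>R e = x - (t - s) *\<^sub>R e" for s by (simp add: algebra_simps)
    then have "dir_deriv e p (x - t *\<^sub>R e) = deriv (\<lambda>s. poly (Polynomial.smult (1 / d) F) (t - s)) 0"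
      by (simp only: dir_deriv_def line)
    also have "\<dots> = poly (- pderiv (Polynomial.smult (1 / d) F)) t"
      by (rule DERIV_imp_deriv, rule DERIV_cong, rule DERIV_chain2[OF poly_DERIV])
        (auto intro!: derivative_eq_intros)
    finally show ?thesis .
  qed
  \<comment> \<open>\<open>line_poly\<close> is a definite description; uniqueness holds because
    real polynomials with equal values everywhere are equal.\<close>
  have "line_poly (dir_deriv e p) e x = - pderiv (Polynomial.smult (1 / d) F)"
    unfolding line_poly_def
  proof (rule the_equality)
    fix q assume "\<forall>t. poly q t = dir_deriv e p (x - t *\<^sub>R e)"
    then show "q = - pderiv (Polynomial.smult (1 / d) F)"
      using dline by (metis poly_eq_poly_eq_iff ext)
  qed (simp add: dline)
  also have "\<dots> = Polynomial.smult (- 1 / d) (pderiv F)" by (simp add: pderiv_smult)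
  finally have lp: "line_poly (dir_deriv e p) e x = Polynomial.smult (- 1 / d) (pderiv F)" .
  have "map_poly complex_of_real (Polynomial.smult (- 1 / d) (pderiv F)) =
      Polynomial.smult (complex_of_real (- 1 / d)) (map_poly complex_of_real (pderiv F))"
    by (rule of_real_hom.map_poly_hom_smult)
  then have "poly (map_poly complex_of_real (Polynomial.smult (- 1 / d) (pderiv F))) z = 0
      \<longleftrightarrow> poly (map_poly complex_of_real (pderiv F)) z = 0" for z
    using d by (simp only: poly_smult) simp
  then have "line_roots (dir_deriv e p) e x = {z. poly (map_poly complex_of_real (pderiv F)) z = 0}"
    by (simp add: line_roots_def lp)
  then show ?thesis
    using pderiv_linear_prod_roots_nonneg_iff[of "{..<l}" lam] l
    by (simp add: hyperbolicity_cone_def F_def lessThan_empty_iff)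
qed

section \<open>The Gram matrix as a spectrahedral representation\<close>

theorem corollary1:
  fixes l :: nat
    and A :: "'n::finite \<Rightarrow> real mat"
    and e :: "real ^ 'n"
    and p :: "real ^ 'n \<Rightarrow> real"
  assumes "l \<ge> 1"
    and "\<And>k. sym_mat l (A k)"
    and "pd_mat l (lin_pencil l A e)"
    and "\<And>x. p x = Determinant.det (lin_pencil l A x)"
  shows "spectrahedral_rep (((l + 1) choose 2) - 1) (hyperbolicity_cone (dir_deriv e p) e)"
proof -
  define G where "G = lin_pencil l A e"
  \<comment> \<open>For \<open>l = 1\<close> this is 0: the representing pencil is the empty matrix
    and the cone is the whole space.\<close>
  define N where "N = ((l + 1) choose 2) - 1"
  have l: "0 < l" and G: "pd_mat l G" and Gs: "sym_mat l G" and Gc: "G \<in> carrier_mat l l"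
    using assms by (auto simp: G_def pd_mat_def sym_mat_def)
  have Ac: "A k \<in> carrier_mat l l" for k using assms(2)[of k] by (simp add: sym_mat_def)
  have Xs: "sym_mat l (lin_pencil l A x)" for x
    unfolding lin_pencil_eq_lincomb by (rule sym_mat_lincomb) (rule assms(2))
  have Xc: "lin_pencil l A x \<in> carrier_mat l l" for x by (simp add: lin_pencil_def)
  obtain B where B: "\<And>m. B m \<in> trace_orthogonal l G"
    and span: "\<And>Y. Y \<in> trace_orthogonal l G \<Longrightarrow> \<exists>c. Y = mat_lincomb l {..<N} c B"
    using trace_orthogonal_spanning[OF l G] unfolding N_def by blast
  have Bs: "sym_mat l (B m)" and Bc: "B m \<in> carrier_mat l l" and B0: "mat_trace (G * B m) = 0" for m
    using B[of m] by (auto simp: trace_orthogonal_def sym_mat_def)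
  have lincomb: "mat_lincomb l {..<N} c B \<in> trace_orthogonal l G" for c
  proof -
    have "mat_trace (G * mat_lincomb l {..<N} c B) = mat_trace (mat_lincomb l {..<N} c B * G)"
      by (rule mat_trace_mult_commute[OF Gc]) simp
    also have "\<dots> = (\<Sum>m<N. c m * mat_trace (B m * G))"
      by (rule mat_trace_lincomb_mult[OF Bc Gc])
    also have "\<dots> = 0" using B0 mat_trace_mult_commute[OF Gc Bc] by simp
    finally show ?thesis using Bs by (simp add: trace_orthogonal_def sym_mat_lincomb)
  qed
  \<comment> \<open>The Gram matrix of the trace form of \<open>A k\<close> on the family
    \<open>B\<close>. The form is linear in \<open>A k\<close>, so the pencil of \<open>C\<close> at
    \<open>x\<close> is the Gram matrix belonging to the pencil of \<open>A\<close> at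
    \<open>x\<close>.\<close>
  define C where "C k = mat N N (\<lambda>(i, j). trace_form G (A k) (B i) (B j))" for k
  have Cs: "sym_mat N (C k)" for k
    by (auto simp: sym_mat_def C_def trace_form_commute[OF Gc Gs assms(2) Bs Bs] intro!: eq_matI)
  have CX: "lin_pencil N C x = mat N N (\<lambda>(i, j). trace_form G (lin_pencil l A x) (B i) (B j))" for x
    unfolding lin_pencil_eq_lincomb[of l]
    by (auto simp: lin_pencil_def C_def trace_form_lincomb(1)[OF Gc Ac Bc Bc] mult.commute intro!: eq_matI)
  have form: "v \<bullet> (lin_pencil N C x *\<^sub>v v) = trace_form G (lin_pencil l A x)
      (mat_lincomb l {..<N} (vec_index v) B) (mat_lincomb l {..<N} (vec_index v) B)"
    if "v \<in> carrier_vec N" for v x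
  proof -
    have "v \<bullet> (lin_pencil N C x *\<^sub>v v) =
        (\<Sum>i<N. v $ i * (\<Sum>j<N. trace_form G (lin_pencil l A x) (B i) (B j) * v $ j))"
      using that by (simp add: CX scalar_prod_def atLeast0LessThan)
    then show ?thesis
      by (simp add: trace_form_lincomb(2)[OF Gc Bc Xc] trace_form_lincomb(3)[OF Gc Bc Xc Bc] mult.commute)
  qed
  \<comment> \<open>Vectors are read as coefficients with respect to \<open>B\<close>. By
    \<open>lincomb\<close> and \<open>span\<close> the resulting combinations are exactly the
    members of \<open>trace_orthogonal l G\<close>.\<close>
  have psd: "psd_mat N (lin_pencil N C x) \<longleftrightarrow>
      (\<forall>Y\<in>trace_orthogonal l G. 0 \<le> trace_form G (lin_pencil l A x) Y Y)" for x
  proof -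
    have "sym_mat N (lin_pencil N C x)"
      unfolding lin_pencil_eq_lincomb by (rule sym_mat_lincomb) (rule Cs)
    then have "psd_mat N (lin_pencil N C x) \<longleftrightarrow>
       (\<forall>v\<in>carrier_vec N. 0 \<le> trace_form G (lin_pencil l A x)
      (mat_lincomb l {..<N} (vec_index v) B) (mat_lincomb l {..<N} (vec_index v) B))"
      by (simp add: psd_mat_def form)
    also have "\<dots> \<longleftrightarrow> (\<forall>Y\<in>trace_orthogonal l G. 0 \<le> trace_form G (lin_pencil l A x) Y Y)"
    proof (intro iffI ballI)
      fix Y assume *: "\<forall>v\<in>carrier_vec N. 0 \<le> trace_form G (lin_pencil l A x)
        (mat_lincomb l {..<N} (vec_index v) B) (mat_lincomb l {..<N} (vec_index v) B)"
        and "Y \<in> trace_orthogonal l G"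
      then obtain c where c: "Y = mat_lincomb l {..<N} c B" using span by blast
      then have "Y = mat_lincomb l {..<N} (vec_index (Matrix.vec N c)) B"
        by (simp add: mat_lincomb_def)
      then show "0 \<le> trace_form G (lin_pencil l A x) Y Y"
        using * vec_carrier by metis
    qed (use lincomb in blast)
    finally show ?thesis .
  qed
  have "x \<in> hyperbolicity_cone (dir_deriv e p) e \<longleftrightarrow> psd_mat N (lin_pencil N C x)" for x
  proof -
    \<comment> \<open>\<open>P\<close> and \<open>lam\<close> vary with \<open>x\<close>, whereas
      \<open>C\<close> is already fixed; the eigenvalue condition links both sides for each
      \<open>x\<close> separately.\<close>
    obtain P lam where P: "P \<in> carrier_mat l l" "transpose_mat P * (G * P) = 1\<^sub>m l"
      "transpose_mat P * (lin_pencil l A x * P) = mat_diag l lam"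
      using simultaneous_diagonalization_mat[OF Xs G] by blast
    show ?thesis
      unfolding psd trace_form_nonneg_iff[OF P(1) Gs Xs P(2,3)]
      by (rule hyperbolicity_cone_dir_deriv_iff[OF l assms(2) P(1) P(2)[unfolded G_def] P(3) assms(4)])
  qed
  then show ?thesis
    unfolding spectrahedral_rep_def N_def[symmetric] using Cs by blast
qed

end
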